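(* Let $n \ge 3$ be odd. Let $K_{n,n}$ be the complete bipartite graph with bipartition sets $\{a_0,\dots,a_{n-1}\}$ and $\{b_0,\dots,b_{n-1}\}$ (indices modulo $n$). Define the following permutations of its vertex set: $\rho_1$ maps $a_i \mapsto a_{i+1}$ and fixes every $b_i$; $\rho_2$ maps $b_i \mapsto b_{i+1}$ and fixes every $a_i$; $\tau$ swaps $a_i \leftrightarrow b_i$ for every $i$ (so $\tau$ is an involution commuting with $\rho_1\rho_2$ and switching the bipartition sets); $\sigma_2$ maps $b_i \mapsto b_{-i}$ and fixes every $a_i$ (an involution on the second bipartition set inverting $\rho_2$, fixing $b_0$). Let $G=\langle \rho_1,\rho_2,\tau\rangle$; then $G \cong C_n \times D_{2n}$ and $G$ acts regularly on the arcs (ordered pairs of adjacent vertices) of $K_{n,n}$. The line graph $\mathcal{L}(\mathcal{S}(K_{n,n}))$ of the subdivision graph of $K_{n,n}$ has as vertices the edges of $\mathcal{S}(K_{n,n})$, i.e. the half-edges of $K_{n,n}$, which correspond to arcs $(u,w)$ of $K_{n,n}$ (the half-edge joining $u$ to the subdivision vertex of $\{u,w\}$). Label the arc $g\cdot(a_0,b_0)$ by $g \in G$; this identifies $\mathcal{L}(\mathcal{S}(K_{n,n}))$ with the Cayley graph $\mathrm{Cay}(G,C)$ where $C=\{\tau\}\cup\{\rho_2^i : 1 \le i \le n-1\}$. Under this identification, the graph $\mathcal{L}(\mathcal{S}(K_{n,n}))$ viewed as a Cayley graph on $C_n\times D_{2n}$ is non-CCA. Specifically, the permutation of $G$ induced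 by $\sigma_2$ (namely $g \mapsto$ the unique $h\in G$ with $h\cdot(a_0,b_0) = \sigma_2 g\cdot (a_0,b_0)$) is a colour-preserving automorphism of $\mathrm{Cay}(G,C)$ that is not affine.
   Context: For a group $G$ and $C \subseteq G\setminus\{e\}$, the Cayley graph $\mathrm{Cay}(G,C)$ has vertex set $G$ and an edge between $g$ and $gc$ for each $g\in G$, $c \in C$. Its edges are naturally coloured: the edge $\{g,gc\}$ receives the colour $\{c,c^{-1}\}$. A colour-preserving automorphism is a graph automorphism that maps each edge to an edge of the same colour. A permutation of $G$ is affine if it is of the form $g \mapsto h\alpha(g)$ for some $h\in G$ and group automorphism $\alpha$ of $G$ (equivalently, it normalises the group of left translations of $G$). A Cayley graph $\mathrm{Cay}(G,C)$ is CCA (Cayley Colour Automorphism property) if every colour-preserving automorphism of it is affine; otherwise it is non-CCA. $C_n$ denotes the cyclic group of order $n$ and $D_{2n}$ the dihedral group of order $2n$. $\mathcal{S}(\Gamma)$ is the subdivision graph (each edge replaced by a path of length 2) and $\mathcal{L}(\Gamma)$ is the line graph. *)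

theory Defs
  imports "HOL-Algebra.Group_Action" "HOL-Algebra.Elementary_Groups"
begin

section \<open>Simple graphs\<close>

text \<open>Edges are two-element sets of vertices.\<close>

record 'a ugraph =
  verts :: "'a set"
  edges :: "'a set set"

definition graph_iso :: "('a \<Rightarrow> 'b) \<Rightarrow> 'a ugraph \<Rightarrow> 'b ugraph \<Rightarrow> bool" where
  "graph_iso f X Y \<longleftrightarrow>
     bij_betw f (verts X) (verts Y) \<and>
     (\<forall>x\<in>verts X. \<forall>y\<in>verts X. {x, y} \<in> edges X \<longleftrightarrow> {f x, f y} \<in> edges Y)"

definition graph_isomorphic :: "'a ugraph \<Rightarrow> 'b ugraph \<Rightarrow> bool" where
  "graph_isomorphic X Y \<longleftrightarrow> (\<exists>f. graph_iso f X Y)"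

definition arcs :: "'a ugraph \<Rightarrow> ('a \<times> 'a) set" where
  "arcs X = {(u, w). {u, w} \<in> edges X}"

text \<open>The vertex \<open>Inr e\<close> of the subdivision is the midpoint of the edge \<open>e\<close>.\<close>

definition subdivision :: "'a ugraph \<Rightarrow> ('a + 'a set) ugraph" where
  "subdivision X =
     \<lparr>verts = Inl ` verts X \<union> Inr ` edges X,
      edges = {{Inl v, Inr e} | v e. e \<in> edges X \<and> v \<in> e}\<rparr>"

definition line_graph :: "'a ugraph \<Rightarrow> 'a set ugraph" where
  "line_graph X =
     \<lparr>verts = edges X,
      edges = {{e, f} | e f. e \<in> edges X \<and> f \<in> edges X \<and> e \<noteq> f \<and> e \<inter> f \<noteq> {}}\<rparr>"

fun half_edge :: "'a \<times> 'a \<Rightarrow> ('a + 'a set) set" where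
  "half_edge (u, w) = {Inl u, Inr {u, w}}"


section \<open>Cayley graphs and the CCA property\<close>

definition cayley_graph :: "('g, 'm) monoid_scheme \<Rightarrow> 'g set \<Rightarrow> 'g ugraph" where
  "cayley_graph G C =
     \<lparr>verts = carrier G,
      edges = {{g, g \<otimes>\<^bsub>G\<^esub> c} | g c. g \<in> carrier G \<and> c \<in> C}\<rparr>"

text \<open>\<open>cayley_coloured G C E K\<close>: the set \<open>E\<close> is an edge of the Cayley graph and its colour
  is \<open>K\<close>. The colour is unique: if \<open>{g, gc} = {h, hd}\<close> then \<open>d\<close> is \<open>c\<close> or the inverse of \<open>c\<close>.\<close>

definition cayley_coloured ::
    "('g, 'm) monoid_scheme \<Rightarrow> 'g set \<Rightarrow> 'g set \<Rightarrow> 'g set \<Rightarrow> bool" where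
  "cayley_coloured G C E K \<longleftrightarrow>
     (\<exists>g\<in>carrier G. \<exists>c\<in>C. E = {g, g \<otimes>\<^bsub>G\<^esub> c} \<and> K = {c, inv\<^bsub>G\<^esub> c})"

definition colour_preserving_automorphism ::
    "('g, 'm) monoid_scheme \<Rightarrow> 'g set \<Rightarrow> ('g \<Rightarrow> 'g) \<Rightarrow> bool" where
  "colour_preserving_automorphism G C f \<longleftrightarrow>
     graph_iso f (cayley_graph G C) (cayley_graph G C) \<and>
     (\<forall>E K. cayley_coloured G C E K \<longrightarrow> cayley_coloured G C (f ` E) K)"

definition affine_map :: "('g, 'm) monoid_scheme \<Rightarrow> ('g \<Rightarrow> 'g) \<Rightarrow> bool" where
  "affine_map G f \<longleftrightarrow>
     (\<exists>h\<in>carrier G. \<exists>\<alpha>\<in>auto G. \<forall>g\<in>carrier G. f g = h \<otimes>\<^bsub>G\<^esub> \<alpha> g)"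

definition CCA :: "('g, 'm) monoid_scheme \<Rightarrow> 'g set \<Rightarrow> bool" where
  "CCA G C \<longleftrightarrow> (\<forall>f. colour_preserving_automorphism G C f \<longrightarrow> affine_map G f)"


section \<open>Dihedral groups and regular actions\<close>

text \<open>The dihedral group of order \<open>2n\<close>, for \<open>n > 0\<close>: the pair \<open>(i, s)\<close> stands for
  \<open>r\<^sup>i\<close> if \<open>s\<close> is false and for \<open>r\<^sup>i t\<close> if \<open>s\<close> is true, where \<open>r\<close> has order \<open>n\<close> and the
  reflection \<open>t\<close> inverts \<open>r\<close>.\<close>

definition dihedral_group :: "nat \<Rightarrow> (int \<times> bool) monoid" where
  "dihedral_group n =
     \<lparr>carrier = {0..<int n} \<times> UNIV,
      monoid.mult = (\<lambda>(i, s) (j, t). ((if s then i - j else i + j) mod int n, s \<noteq> t)),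
      one = (0, False)\<rparr>"

definition regular_action ::
    "('g, 'm) monoid_scheme \<Rightarrow> 'x set \<Rightarrow> ('g \<Rightarrow> 'x \<Rightarrow> 'x) \<Rightarrow> bool" where
  "regular_action G X \<phi> \<longleftrightarrow>
     transitive_action G X \<phi> \<and> (\<forall>x\<in>X. stabilizer G \<phi> x = {\<one>\<^bsub>G\<^esub>})"


section \<open>The complete bipartite graph and its permutations\<close>

text \<open>The indices modulo \<open>n\<close> are represented by \<open>{0..<int n}\<close>.\<close>

datatype bip = A int | B int

definition side_A :: "nat \<Rightarrow> bip set" where
  "side_A n = A ` {0..<int n}"

definition side_B :: "nat \<Rightarrow> bip set" where
  "side_B n = B ` {0..<int n}"

definition Knn :: "nat \<Rightarrow> bip ugraph" where
  "Knn n =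
     \<lparr>verts = side_A n \<union> side_B n,
      edges = {{a, b} | a b. a \<in> side_A n \<and> b \<in> side_B n}\<rparr>"

text \<open>Permutations are extensional functions, so that they are elements of
  \<open>BijGroup (verts (Knn n))\<close>, whose product is composition, the right factor acting first.\<close>

definition rho1 :: "nat \<Rightarrow> bip \<Rightarrow> bip" where
  "rho1 n = (\<lambda>v\<in>verts (Knn n). case v of A i \<Rightarrow> A ((i + 1) mod int n) | B i \<Rightarrow> B i)"

definition rho2 :: "nat \<Rightarrow> bip \<Rightarrow> bip" where
  "rho2 n = (\<lambda>v\<in>verts (Knn n). case v of A i \<Rightarrow> A i | B i \<Rightarrow> B ((i + 1) mod int n))"

definition tau :: "nat \<Rightarrow> bip \<Rightarrow> bip" where
  "tau n = (\<lambda>v\<in>verts (Knn n). case v of A i \<Rightarrow> B i | B i \<Rightarrow> A i)"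

definition sigma2 :: "nat \<Rightarrow> bip \<Rightarrow> bip" where
  "sigma2 n = (\<lambda>v\<in>verts (Knn n). case v of A i \<Rightarrow> A i | B i \<Rightarrow> B ((- i) mod int n))"

definition Knn_group :: "nat \<Rightarrow> (bip \<Rightarrow> bip) monoid" where
  "Knn_group n = subgroup_generated (BijGroup (verts (Knn n))) {rho1 n, rho2 n, tau n}"

definition Knn_conn :: "nat \<Rightarrow> (bip \<Rightarrow> bip) set" where
  "Knn_conn n = {tau n} \<union> {rho2 n [^]\<^bsub>Knn_group n\<^esub> i | i::nat. 1 \<le> i \<and> i \<le> n - 1}"

definition arc_action :: "'a ugraph \<Rightarrow> ('a \<Rightarrow> 'a) \<Rightarrow> 'a \<times> 'a \<Rightarrow> 'a \<times> 'a" where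
  "arc_action X g = (\<lambda>(u, w)\<in>arcs X. (g u, g w))"

definition arc_of :: "nat \<Rightarrow> (bip \<Rightarrow> bip) \<Rightarrow> bip \<times> bip" where
  "arc_of n g = arc_action (Knn n) g (A 0, B 0)"

text \<open>The permutation of the group induced by \<open>\<sigma>\<^sub>2\<close> through the labelling \<open>arc_of\<close> of the arcs.\<close>

definition sigma2_induced :: "nat \<Rightarrow> (bip \<Rightarrow> bip) \<Rightarrow> (bip \<Rightarrow> bip)" where
  "sigma2_induced n g =
     (THE h. h \<in> carrier (Knn_group n) \<and>
             arc_of n h = arc_action (Knn n) (sigma2 n) (arc_of n g))"

end

theory Submission
  imports Defs
begin

text \<open>Every element of the group is \<open>\<rho>\<^sub>1\<^sup>i \<rho>\<^sub>2\<^sup>j\<close> or \<open>\<rho>\<^sub>1\<^sup>i \<rho>\<^sub>2\<^sup>j \<tau>\<close> with \<open>i\<close>, \<open>j\<close> modulo \<open>n\<close>, and these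
  correspond to the arcs \<open>(a\<^sub>i, b\<^sub>j)\<close> and \<open>(b\<^sub>j, a\<^sub>i)\<close>. Right multiplication by \<open>\<tau>\<close> reverses an arc
  and right multiplication by a power of \<open>\<rho>\<^sub>2\<close> moves its head, so the Cayley graph is the line graph
  of the subdivision. In these coordinates \<open>\<sigma>\<^sub>2\<close> replaces \<open>j\<close> by \<open>-j\<close>: it respects the edges coloured
  \<open>{\<tau>}\<close>, and an edge coloured \<open>{\<rho>\<^sub>2\<^sup>k, \<rho>\<^sub>2\<^sup>-\<^sup>k}\<close> has its direction reversed if its tail is in the first
  side and kept otherwise, so the colour survives. This mixture of the two behaviours is not
  multiplicative.\<close>

section \<open>Cayley graphs under group isomorphisms\<close>

lemma graph_iso_inv_into:
  assumes "graph_iso f X Y"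
  shows "graph_iso (inv_into (verts X) f) Y X"
proof -
  let ?g = "inv_into (verts X) f"
  from assms have bij: "bij_betw f (verts X) (verts Y)"
    and E: "\<And>x y. x \<in> verts X \<Longrightarrow> y \<in> verts X \<Longrightarrow> {x, y} \<in> edges X \<longleftrightarrow> {f x, f y} \<in> edges Y"
    by (auto simp: graph_iso_def)
  have "f (?g y) = y" "?g y \<in> verts X" if "y \<in> verts Y" for y
    using bij that by (auto simp: bij_betw_inv_into_right bij_betw_def intro: inv_into_into)
  then show ?thesis
    using bij E by (simp add: graph_iso_def bij_betw_inv_into)
qed

lemma graph_iso_comp:
  assumes "graph_iso f X Y" "graph_iso g Y Z"
  shows "graph_iso (g \<circ> f) X Z"
proof -
  have "f x \<in> verts Y" if "x \<in> verts X" for x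
    using assms(1) that by (auto simp: graph_iso_def bij_betw_def)
  then show ?thesis
    using assms by (auto simp: graph_iso_def intro: bij_betw_trans)
qed

text \<open>A homomorphism carries \<open>{g, gc}\<close> to an edge. Conversely, an edge between
  two images starts at some \<open>\<phi> g\<close>, and injectivity on the carrier cancels
  \<open>\<phi>\<close> from the resulting equation of sets.\<close>

lemma graph_iso_cayley_graph:
  fixes G (structure)
  assumes \<phi>: "\<phi> \<in> iso G H" and C: "C \<subseteq> carrier G" and "group G"
  shows "graph_iso \<phi> (cayley_graph G C) (cayley_graph H (\<phi> ` C))"
proof -
  interpret group G by fact
  from \<phi> have bij: "bij_betw \<phi> (carrier G) (carrier H)" and hom: "\<phi> \<in> hom G H"
    by (auto simp: iso_def)
  have inj: "inj_on \<phi> (carrier G)"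
    using bij by (simp add: bij_betw_def)
  have "{x, y} \<in> edges (cayley_graph G C) \<longleftrightarrow> {\<phi> x, \<phi> y} \<in> edges (cayley_graph H (\<phi> ` C))"
    if xy: "x \<in> carrier G" "y \<in> carrier G" for x y
  proof
    assume "{x, y} \<in> edges (cayley_graph G C)"
    then obtain g c where gc: "g \<in> carrier G" "c \<in> C" "{x, y} = {g, g \<otimes> c}"
      by (auto simp: cayley_graph_def)
    have "{\<phi> x, \<phi> y} = \<phi> ` {g, g \<otimes> c}"
      unfolding gc(3)[symmetric] by simp
    also have "\<dots> = {\<phi> g, \<phi> g \<otimes>\<^bsub>H\<^esub> \<phi> c}"
      using gc C by (simp add: hom_mult[OF hom] subsetD)
    finally show "{\<phi> x, \<phi> y} \<in> edges (cayley_graph H (\<phi> ` C))"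
      using gc hom_in_carrier[OF hom] unfolding cayley_graph_def by simp blast
  next
    assume "{\<phi> x, \<phi> y} \<in> edges (cayley_graph H (\<phi> ` C))"
    then obtain h c where hc: "h \<in> carrier H" "c \<in> C" "{\<phi> x, \<phi> y} = {h, h \<otimes>\<^bsub>H\<^esub> \<phi> c}"
      by (auto simp: cayley_graph_def)
    then obtain g where g: "g \<in> carrier G" "h = \<phi> g"
      using bij by (auto simp: bij_betw_def)
    have "\<phi> ` {x, y} = \<phi> ` {g, g \<otimes> c}"
      using hc g C by (simp add: hom_mult[OF hom] subsetD)
    then have "{x, y} = {g, g \<otimes> c}"
      using inj xy g hc C by (subst (asm) inj_on_image_eq_iff) auto
    then show "{x, y} \<in> edges (cayley_graph G C)"
      using g hc by (auto simp: cayley_graph_def)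
  qed
  with bij show ?thesis
    by (simp add: graph_iso_def cayley_graph_def)
qed

lemma cayley_coloured_iso:
  assumes \<phi>: "\<phi> \<in> iso G H" and C: "C \<subseteq> carrier G" and G: "group G" and H: "group H"
    and col: "cayley_coloured G C E K"
  shows "cayley_coloured H (\<phi> ` C) (\<phi> ` E) (\<phi> ` K)"
proof -
  interpret group_hom G H \<phi>
    using \<phi> G H by (simp add: group_hom_def group_hom_axioms_def iso_def)
  show ?thesis
    using col C by (fastforce simp: cayley_coloured_def)
qed

text \<open>If \<open>f'\<close> is \<open>h\<close> times \<open>\<alpha>\<close>, multiplicativity
  of \<open>\<psi>\<close> splits the conjugate into the translation by \<open>\<psi> h\<close> and
  the automorphism \<open>\<psi> \<circ> \<alpha> \<circ> \<phi>\<close>.\<close>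

lemma affine_map_conjugate:
  fixes G (structure)
  assumes \<phi>: "\<phi> \<in> iso G H" and \<psi>: "\<psi> \<in> iso H G" and G: "group G"
    and f: "\<And>g. g \<in> carrier G \<Longrightarrow> f g = \<psi> (f' (\<phi> g))"
    and aff: "affine_map H f'"
  shows "affine_map G f"
proof -
  interpret group G by fact
  from aff obtain h \<alpha> where h: "h \<in> carrier H" and \<alpha>: "\<alpha> \<in> auto H"
    and f': "\<And>g. g \<in> carrier H \<Longrightarrow> f' g = h \<otimes>\<^bsub>H\<^esub> \<alpha> g"
    by (auto simp: affine_map_def)
  have "\<alpha> \<in> iso H H"
    using \<alpha> by (auto simp: auto_def Bij_def iso_def)
  then have iso: "\<psi> \<circ> \<alpha> \<circ> \<phi> \<in> iso G G"
    using \<phi> \<psi> by (metis iso_set_trans comp_assoc)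
  \<comment> \<open>Members of \<open>auto\<close> are extensional, so the composite is cut down to
    the carrier.\<close>
  then have "restrict (\<psi> \<circ> \<alpha> \<circ> \<phi>) (carrier G) \<in> auto G"
    by (auto simp: auto_def Bij_def iso_def hom_def)
  moreover have "f g = \<psi> h \<otimes> restrict (\<psi> \<circ> \<alpha> \<circ> \<phi>) (carrier G) g" if g: "g \<in> carrier G" for g
  proof -
    have "\<phi> g \<in> carrier H"
      using \<phi> g by (auto simp: iso_def hom_def)
    moreover from this have "\<alpha> (\<phi> g) \<in> carrier H"
      using \<alpha> by (auto simp: auto_def hom_def)
    ultimately show ?thesis
      using \<psi> g h by (simp add: f f' iso_def hom_mult)
  qed
  moreover have "\<psi> h \<in> carrier G"
    using \<psi> h by (auto simp: iso_def hom_def)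
  ultimately show ?thesis
    unfolding affine_map_def by blast
qed

text \<open>Conjugation by \<open>\<phi>\<close> turns a colour-preserving automorphism over
  \<open>G\<close> into one over \<open>H\<close>, and affineness pulls back. The contrapositive
  carries the failure of CCA from the permutation group to the abstract product.\<close>

lemma CCA_iso:
  assumes \<phi>: "\<phi> \<in> iso G H" and C: "C \<subseteq> carrier G" and G: "group G" and H: "group H"
    and CCA: "CCA H (\<phi> ` C)"
  shows "CCA G C"
  unfolding CCA_def
proof (intro allI impI)
  fix f assume f: "colour_preserving_automorphism G C f"
  define \<psi> where "\<psi> = inv_into (carrier G) \<phi>"
  have \<psi>: "\<psi> \<in> iso H G"
    unfolding \<psi>_def by (rule group.iso_set_sym[OF G \<phi>])
  have bij: "bij_betw \<phi> (carrier G) (carrier H)"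
    using \<phi> by (simp add: iso_def)
  have \<psi>\<phi>: "\<psi> (\<phi> g) = g" if "g \<in> carrier G" for g
    using bij that by (simp add: \<psi>_def bij_betw_inv_into_left)
  have \<phi>\<psi>: "\<phi> (\<psi> h) = h" if "h \<in> carrier H" for h
    using bij that by (simp add: \<psi>_def bij_betw_inv_into_right)
  have \<psi>C: "\<psi> ` \<phi> ` C = C"
    using C \<psi>\<phi> by (force simp: image_image)
  have \<phi>C: "\<phi> ` C \<subseteq> carrier H"
    using C bij by (auto simp: bij_betw_def)
  let ?f = "\<phi> \<circ> f \<circ> \<psi>"
  have iso_\<psi>: "graph_iso \<psi> (cayley_graph H (\<phi> ` C)) (cayley_graph G C)"
    using graph_iso_cayley_graph[OF \<psi> \<phi>C H] by (simp add: \<psi>C)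
  have iso_f: "graph_iso f (cayley_graph G C) (cayley_graph G C)"
    and col_f: "\<And>E K. cayley_coloured G C E K \<Longrightarrow> cayley_coloured G C (f ` E) K"
    using f by (auto simp: colour_preserving_automorphism_def)
  have "graph_iso ?f (cayley_graph H (\<phi> ` C)) (cayley_graph H (\<phi> ` C))"
    using graph_iso_comp[OF iso_\<psi> graph_iso_comp[OF iso_f graph_iso_cayley_graph[OF \<phi> C G]]] .
  moreover have "cayley_coloured H (\<phi> ` C) (?f ` E) K"
    if E: "cayley_coloured H (\<phi> ` C) E K" for E K
  proof -
    have "cayley_coloured G C (\<psi> ` E) (\<psi> ` K)"
      using cayley_coloured_iso[OF \<psi> \<phi>C H G E] by (simp add: \<psi>C)
    then have "cayley_coloured H (\<phi> ` C) (\<phi> ` f ` \<psi> ` E) (\<phi> ` \<psi> ` K)"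
      by (intro cayley_coloured_iso[OF \<phi> C G H] col_f)
    \<comment> \<open>\<open>\<phi>\<close> undoes \<open>\<psi>\<close> only on the carrier, so the
      colour must lie there to come back unchanged.\<close>
    moreover have "K \<subseteq> carrier H"
      using E \<phi>C group.inv_closed[OF H] by (auto simp: cayley_coloured_def)
    then have "\<phi> ` \<psi> ` K = K"
      using \<phi>\<psi> by (force simp: image_image)
    ultimately show ?thesis
      by (simp add: image_comp comp_assoc)
  qed
  ultimately have "affine_map H ?f"
    using CCA by (simp add: CCA_def colour_preserving_automorphism_def)
  moreover have "f g \<in> carrier G" if "g \<in> carrier G" for g
    using iso_f that by (auto simp: graph_iso_def bij_betw_def cayley_graph_def)
  ultimately show "affine_map G f"
    by (intro affine_map_conjugate[OF \<phi> \<psi> G, of f ?f]) (simp_all add: \<psi>\<phi>)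
qed

text \<open>Closure of \<open>C\<close> under inverses makes orientation irrelevant: an edge based
  at \<open>y\<close> by \<open>c\<close> is also based at \<open>x\<close> by the inverse of
  \<open>c\<close>.\<close>

lemma edges_cayley_graph_iff:
  fixes G (structure)
  assumes "group G" and C: "C \<subseteq> carrier G" and inv: "\<And>c. c \<in> C \<Longrightarrow> inv\<^bsub>G\<^esub> c \<in> C"
    and x: "x \<in> carrier G" and y: "y \<in> carrier G"
  shows "{x, y} \<in> edges (cayley_graph G C) \<longleftrightarrow> (\<exists>c\<in>C. y = x \<otimes>\<^bsub>G\<^esub> c)"
proof -
  interpret group G by fact
  have "x = y \<otimes> inv c" if "c \<in> C" "y = x \<otimes> c" for c
    using that C x by (auto simp: m_assoc)
  moreover have "y = x \<otimes> inv c" if "c \<in> C" "x = y \<otimes> c" for c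
    using that C y by (auto simp: m_assoc)
  ultimately show ?thesis
    using x y inv by (auto simp: cayley_graph_def doubleton_eq_iff)
qed

text \<open>\<open>group_action\<close> asks for a homomorphism into \<open>BijGroup E\<close>.
  Bijectivity of each \<open>\<phi> g\<close> comes from the action of the inverse element.\<close>

lemma group_actionI:
  fixes G (structure)
  assumes G: "group G"
    and ext: "\<And>g. g \<in> carrier G \<Longrightarrow> \<phi> g \<in> extensional E"
    and closed: "\<And>g x. g \<in> carrier G \<Longrightarrow> x \<in> E \<Longrightarrow> \<phi> g x \<in> E"
    and one: "\<And>x. x \<in> E \<Longrightarrow> \<phi> \<one>\<^bsub>G\<^esub> x = x"
    and mult: "\<And>g h x. g \<in> carrier G \<Longrightarrow> h \<in> carrier G \<Longrightarrow> x \<in> E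
                 \<Longrightarrow> \<phi> (g \<otimes>\<^bsub>G\<^esub> h) x = \<phi> g (\<phi> h x)"
  shows "group_action G E \<phi>"
proof -
  interpret group G by fact
  have Bij: "\<phi> g \<in> Bij E" if g: "g \<in> carrier G" for g
  proof -
    have "\<phi> (inv g) (\<phi> g x) = x" "\<phi> g (\<phi> (inv g) x) = x" if "x \<in> E" for x
      using that g one by (simp_all flip: mult)
    then have "bij_betw (\<phi> g) E E"
      using g closed by (intro bij_betw_byWitness[where f' = "\<phi> (inv g)"]) auto
    with ext[OF g] show ?thesis by (simp add: Bij_def)
  qed
  have "\<phi> (g \<otimes> h) = compose E (\<phi> g) (\<phi> h)" if "g \<in> carrier G" "h \<in> carrier G" for g h
    using that by (intro extensionalityI[of _ E]) (auto simp: ext mult compose_def)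
  then have "\<phi> \<in> hom G (BijGroup E)"
    using Bij by (auto simp: hom_def BijGroup_def)
  then show ?thesis
    by (simp add: group_action_def group_hom_def group_hom_axioms_def G group_BijGroup)
qed


section \<open>Normal form of the permutations\<close>

text \<open>\<open>knn_perm n i j s\<close> is \<open>\<rho>\<^sub>1\<^sup>i \<rho>\<^sub>2\<^sup>j\<close>, preceded by \<open>\<tau>\<close> if \<open>s\<close> holds; it carries the arc
  \<open>(a\<^sub>0, b\<^sub>0)\<close> to \<open>(a\<^sub>i, b\<^sub>j)\<close>, respectively to \<open>(b\<^sub>j, a\<^sub>i)\<close>.\<close>

definition knn_perm :: "nat \<Rightarrow> int \<Rightarrow> int \<Rightarrow> bool \<Rightarrow> bip \<Rightarrow> bip" where
  "knn_perm n i j s = (\<lambda>v\<in>verts (Knn n).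
     case v of A k \<Rightarrow> if s then B ((k + j) mod int n) else A ((k + i) mod int n)
             | B k \<Rightarrow> if s then A ((k + i) mod int n) else B ((k + j) mod int n))"

section \<open>Vertices, edges and arcs of the complete bipartite graph\<close>

lemma verts_Knn_simps [simp]:
  "A k \<in> verts (Knn n) \<longleftrightarrow> 0 \<le> k \<and> k < int n"
  "B k \<in> verts (Knn n) \<longleftrightarrow> 0 \<le> k \<and> k < int n"
  by (auto simp: Knn_def side_A_def side_B_def)

lemma verts_Knn_cases:
  assumes "v \<in> verts (Knn n)"
  obtains k where "v = A k" "0 \<le> k" "k < int n" | k where "v = B k" "0 \<le> k" "k < int n"
  using assms by (auto simp: Knn_def side_A_def side_B_def)

lemma verts_Knn_eqI:
  assumes "f \<in> extensional (verts (Knn n))" "g \<in> extensional (verts (Knn n))"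
    and "\<And>k. 0 \<le> k \<Longrightarrow> k < int n \<Longrightarrow> f (A k) = g (A k)"
    and "\<And>k. 0 \<le> k \<Longrightarrow> k < int n \<Longrightarrow> f (B k) = g (B k)"
  shows "f = g"
  using assms(1,2)
proof (rule extensionalityI)
  fix v assume "v \<in> verts (Knn n)"
  then show "f v = g v"
    by (cases rule: verts_Knn_cases) (simp_all add: assms(3,4))
qed

lemma doubleton_in_edges_Knn_iff:
  "{u, w} \<in> edges (Knn n) \<longleftrightarrow>
     u \<in> side_A n \<and> w \<in> side_B n \<or> u \<in> side_B n \<and> w \<in> side_A n"
  unfolding Knn_def by (simp add: doubleton_eq_iff) blast

lemma edges_Knn_simps [simp]:
  "{A i, B j} \<in> edges (Knn n) \<longleftrightarrow> 0 \<le> i \<and> i < int n \<and> 0 \<le> j \<and> j < int n"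
  "{B j, A i} \<in> edges (Knn n) \<longleftrightarrow> 0 \<le> i \<and> i < int n \<and> 0 \<le> j \<and> j < int n"
  "{A i, A j} \<notin> edges (Knn n)"
  "{B i, B j} \<notin> edges (Knn n)"
  by (auto simp: doubleton_in_edges_Knn_iff side_A_def side_B_def)

lemma arcs_Knn_simps [simp]:
  "(A i, B j) \<in> arcs (Knn n) \<longleftrightarrow> 0 \<le> i \<and> i < int n \<and> 0 \<le> j \<and> j < int n"
  "(B j, A i) \<in> arcs (Knn n) \<longleftrightarrow> 0 \<le> i \<and> i < int n \<and> 0 \<le> j \<and> j < int n"
  "(A i, A j) \<notin> arcs (Knn n)"
  "(B i, B j) \<notin> arcs (Knn n)"
  by (auto simp: arcs_def)

lemma arcs_Knn_cases:
  assumes "x \<in> arcs (Knn n)"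
  obtains i j where "x = (A i, B j)" "0 \<le> i" "i < int n" "0 \<le> j" "j < int n"
        | i j where "x = (B j, A i)" "0 \<le> i" "i < int n" "0 \<le> j" "j < int n"
proof -
  obtain u w where x: "x = (u, w)" by (cases x)
  show thesis
    using assms that unfolding x by (cases u; cases w) auto
qed

section \<open>Calculus of the normal forms\<close>

lemma knn_perm_simps [simp]:
  assumes "0 \<le> k" "k < int n"
  shows "knn_perm n i j s (A k) = (if s then B ((k + j) mod int n) else A ((k + i) mod int n))"
    and "knn_perm n i j s (B k) = (if s then A ((k + i) mod int n) else B ((k + j) mod int n))"
  using assms by (simp_all add: knn_perm_def)

text \<open>The images of \<open>A 0\<close> and \<open>B 0\<close> reveal everything: their
  constructors give \<open>s\<close>, their indices give \<open>i\<close> and \<open>j\<close>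
  modulo \<open>n\<close>. Since the parameters are arbitrary integers, products need no
  reduction.\<close>

lemma knn_perm_eq_iff:
  assumes "n > 0"
  shows "knn_perm n i j s = knn_perm n i' j' t \<longleftrightarrow>
           i mod int n = i' mod int n \<and> j mod int n = j' mod int n \<and> s = t"
proof
  assume "knn_perm n i j s = knn_perm n i' j' t"
  then have "knn_perm n i j s (A 0) = knn_perm n i' j' t (A 0)"
    and "knn_perm n i j s (B 0) = knn_perm n i' j' t (B 0)"
    by simp_all
  then show "i mod int n = i' mod int n \<and> j mod int n = j' mod int n \<and> s = t"
    using assms by (simp split: if_splits)
next
  assume *: "i mod int n = i' mod int n \<and> j mod int n = j' mod int n \<and> s = t"
  then have "(k + i) mod int n = (k + i') mod int n" "(k + j) mod int n = (k + j') mod int n" for k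
    by (auto intro: mod_add_cong)
  with * show "knn_perm n i j s = knn_perm n i' j' t"
    unfolding knn_perm_def by (simp only:)
qed

text \<open>Conjugation by \<open>tau\<close> exchanges \<open>rho1\<close> and \<open>rho2\<close>,
  so moving it past the second factor makes the exponents add crosswise.\<close>

lemma compose_knn_perm:
  assumes "n > 0"
  shows "compose (verts (Knn n)) (knn_perm n i j s) (knn_perm n i' j' t) =
           (if s then knn_perm n (i + j') (j + i') (\<not> t) else knn_perm n (i + i') (j + j') t)"
proof (rule extensionalityI[of _ "verts (Knn n)"])
  fix v assume "v \<in> verts (Knn n)"
  then show "compose (verts (Knn n)) (knn_perm n i j s) (knn_perm n i' j' t) v =
      (if s then knn_perm n (i + j') (j + i') (\<not> t) else knn_perm n (i + i') (j + j') t) v"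
    using assms by (cases rule: verts_Knn_cases) (simp_all add: compose_eq mod_simps ac_simps)
qed (auto simp: compose_def knn_perm_def)

lemma knn_perm_0: "knn_perm n 0 0 False = (\<lambda>v\<in>verts (Knn n). v)"
  by (rule verts_Knn_eqI) (auto simp: knn_perm_def)

lemma knn_perm_Bij:
  assumes "n > 0"
  shows "knn_perm n i j s \<in> Bij (verts (Knn n))"
proof -
  let ?V = "verts (Knn n)"
  let ?g = "knn_perm n i j s"
  \<comment> \<open>The inverse, brought to normal form: if \<open>s\<close> holds, moving
    \<open>tau\<close> to the right swaps the negated exponents.\<close>
  let ?h = "knn_perm n (if s then - j else - i) (if s then - i else - j) s"
  have "compose ?V ?h ?g = (\<lambda>v\<in>?V. v)" "compose ?V ?g ?h = (\<lambda>v\<in>?V. v)"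
    using assms by (simp_all add: compose_knn_perm flip: knn_perm_0)
  then have "?h (?g v) = v" "?g (?h v) = v" if "v \<in> ?V" for v
    using that by (metis compose_eq restrict_apply')+
  \<comment> \<open>Quantified over \<open>i\<close> and \<open>j\<close> so that it covers
    \<open>?h\<close> too.\<close>
  moreover have "knn_perm n i j s v \<in> ?V" if "v \<in> ?V" for i j v
    using that assms by (cases rule: verts_Knn_cases) auto
  ultimately have "bij_betw ?g ?V ?V"
    by (intro bij_betw_byWitness[where f' = ?h]) auto
  then show ?thesis
    by (simp add: Bij_def knn_perm_def)
qed

lemma rho1_eq: "rho1 n = knn_perm n 1 0 False"
  by (rule verts_Knn_eqI) (auto simp: knn_perm_def rho1_def)

lemma rho2_eq: "rho2 n = knn_perm n 0 1 False"
  by (rule verts_Knn_eqI) (auto simp: knn_perm_def rho2_def)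

lemma tau_eq: "tau n = knn_perm n 0 0 True"
  by (rule verts_Knn_eqI) (auto simp: knn_perm_def tau_def)

lemma mult_BijGroup_knn_perm:
  assumes "n > 0"
  shows "knn_perm n i j s \<otimes>\<^bsub>BijGroup (verts (Knn n))\<^esub> knn_perm n i' j' t =
           (if s then knn_perm n (i + j') (j + i') (\<not> t) else knn_perm n (i + i') (j + j') t)"
  using assms by (simp add: BijGroup_def knn_perm_Bij compose_knn_perm)

lemma one_BijGroup_Knn: "\<one>\<^bsub>BijGroup (verts (Knn n))\<^esub> = knn_perm n 0 0 False"
  by (simp add: BijGroup_def knn_perm_0)

lemma knn_perm_in_BijGroup: "n > 0 \<Longrightarrow> knn_perm n i j s \<in> carrier (BijGroup (verts (Knn n)))"
  by (simp add: BijGroup_def knn_perm_Bij)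

lemma inv_BijGroup_knn_perm:
  assumes "n > 0"
  shows "inv\<^bsub>BijGroup (verts (Knn n))\<^esub> knn_perm n i j s =
           knn_perm n (if s then - j else - i) (if s then - i else - j) s"
  using assms
  by (intro group.inv_equality[OF group_BijGroup])
    (simp_all add: knn_perm_in_BijGroup mult_BijGroup_knn_perm one_BijGroup_Knn)

section \<open>The reflection of the second side\<close>

lemma sigma2_simps [simp]:
  assumes "0 \<le> k" "k < int n"
  shows "sigma2 n (A k) = A k" and "sigma2 n (B k) = B ((- k) mod int n)"
  using assms by (simp_all add: sigma2_def)

lemma sigma2_in_verts: "v \<in> verts (Knn n) \<Longrightarrow> sigma2 n v \<in> verts (Knn n)"
  by (cases rule: verts_Knn_cases) auto

lemma sigma2_sigma2: "v \<in> verts (Knn n) \<Longrightarrow> sigma2 n (sigma2 n v) = v"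
  by (cases rule: verts_Knn_cases) (auto simp: mod_minus_eq)

lemma sigma2_Bij: "sigma2 n \<in> Bij (verts (Knn n))"
proof -
  have "bij_betw (sigma2 n) (verts (Knn n)) (verts (Knn n))"
    by (rule bij_betw_byWitness[where f' = "sigma2 n"])
      (auto simp: sigma2_in_verts sigma2_sigma2)
  then show ?thesis
    by (simp add: Bij_def sigma2_def)
qed

lemma sigma2_squared:
  "sigma2 n \<otimes>\<^bsub>BijGroup (verts (Knn n))\<^esub> sigma2 n = \<one>\<^bsub>BijGroup (verts (Knn n))\<^esub>"
  by (auto simp: BijGroup_def sigma2_Bij compose_def sigma2_sigma2)

text \<open>In general \<open>sigma2 n\<close> is not one of the maps \<open>knn_perm\<close>, so
  the conjugate is evaluated vertex by vertex.\<close>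

lemma sigma2_inverts_rho2:
  assumes "n > 0"
  shows "sigma2 n \<otimes>\<^bsub>BijGroup (verts (Knn n))\<^esub> rho2 n \<otimes>\<^bsub>BijGroup (verts (Knn n))\<^esub>
           inv\<^bsub>BijGroup (verts (Knn n))\<^esub> sigma2 n = inv\<^bsub>BijGroup (verts (Knn n))\<^esub> rho2 n"
proof -
  let ?V = "verts (Knn n)"
  have "inv\<^bsub>BijGroup ?V\<^esub> sigma2 n = sigma2 n"
    by (intro group.inv_equality[OF group_BijGroup] sigma2_squared)
      (simp_all add: BijGroup_def sigma2_Bij)
  moreover have "compose ?V (compose ?V (sigma2 n) (knn_perm n 0 1 False)) (sigma2 n) =
      knn_perm n 0 (- 1) False"
  proof (rule extensionalityI[of _ ?V])
    fix v assume "v \<in> ?V"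
    then show "compose ?V (compose ?V (sigma2 n) (knn_perm n 0 1 False)) (sigma2 n) v =
        knn_perm n 0 (- 1) False v"
    proof (cases rule: verts_Knn_cases)
      case (2 k)
      \<comment> \<open>The index travels from \<open>k\<close> to \<open>-k\<close>, then to
        \<open>-k + 1\<close>, then to \<open>k - 1\<close>.\<close>
      have "(- ((- k + 1) mod int n)) mod int n = (k - 1) mod int n"
        by (simp add: mod_minus_eq)
      with 2 assms show ?thesis
        by (simp add: compose_eq mod_simps)
    qed (simp add: compose_eq)
  qed (auto simp: compose_def knn_perm_def)
  ultimately show ?thesis
    using assms unfolding rho2_eq
    by (simp add: inv_BijGroup_knn_perm) (simp add: BijGroup_def sigma2_Bij knn_perm_Bij compose_Bij)
qed


section \<open>The group and its regular action on arcs\<close>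

lemma mult_Knn_group:
  assumes "n > 0"
  shows "knn_perm n i j s \<otimes>\<^bsub>Knn_group n\<^esub> knn_perm n i' j' t =
           (if s then knn_perm n (i + j') (j + i') (\<not> t) else knn_perm n (i + i') (j + j') t)"
  using assms by (simp add: Knn_group_def mult_BijGroup_knn_perm)

lemma one_Knn_group: "\<one>\<^bsub>Knn_group n\<^esub> = knn_perm n 0 0 False"
  by (simp add: Knn_group_def one_BijGroup_Knn)

lemma group_Knn_group: "group (Knn_group n)"
  by (simp add: Knn_group_def group.group_subgroup_generated group_BijGroup)

lemma pow_Knn_group:
  assumes "n > 0"
  shows "knn_perm n i j False [^]\<^bsub>Knn_group n\<^esub> (k :: nat) = knn_perm n (int k * i) (int k * j) False"
proof (induction k)
  case 0
  then show ?case
    by (simp add: one_Knn_group nat_pow_def)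
next
  case (Suc k)
  then show ?case
    using assms by (simp add: nat_pow_def mult_Knn_group algebra_simps)
qed

text \<open>The normal forms are a subgroup containing the generators, which bounds the generated
  group from above; each of them is a product of powers of generators, which bounds it from
  below.\<close>

lemma carrier_Knn_group:
  assumes "n > 0"
  shows "carrier (Knn_group n) = {knn_perm n i j s | i j s. True}"
proof
  let ?X = "BijGroup (verts (Knn n))"
  have "subgroup {knn_perm n i j s | i j s. True} ?X"
  proof (rule group.subgroupI[OF group_BijGroup])
    show "inv\<^bsub>?X\<^esub> a \<in> {knn_perm n i j s | i j s. True}"
      if "a \<in> {knn_perm n i j s | i j s. True}" for a
      using that by (clarsimp simp: inv_BijGroup_knn_perm[OF assms] split del: if_split) blast
    show "a \<otimes>\<^bsub>?X\<^esub> b \<in> {knn_perm n i j s | i j s. True}"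
      if "a \<in> {knn_perm n i j s | i j s. True}" "b \<in> {knn_perm n i j s | i j s. True}" for a b
      using that by (clarsimp simp: mult_BijGroup_knn_perm[OF assms] split del: if_split) metis
  qed (use assms in \<open>auto simp: knn_perm_in_BijGroup\<close>)
  then show "carrier (Knn_group n) \<subseteq> {knn_perm n i j s | i j s. True}"
    unfolding Knn_group_def
    by (rule group.subgroup_generated_minimal[OF group_BijGroup])
      (auto simp: rho1_eq rho2_eq tau_eq)
next
  interpret group "Knn_group n" by (rule group_Knn_group)
  have gens: "{rho1 n, rho2 n, tau n} \<subseteq> carrier (Knn_group n)"
    unfolding Knn_group_def
    by (rule group.subgroup_generated_subset_carrier_subset[OF group_BijGroup])
      (simp add: rho1_eq rho2_eq tau_eq knn_perm_in_BijGroup assms)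
  have "knn_perm n i j s \<in> carrier (Knn_group n)" for i j s
  proof -
    \<comment> \<open>Reduction modulo \<open>n\<close> turns the integer exponents into natural
      ones without changing the permutation.\<close>
    let ?r1 = "rho1 n [^]\<^bsub>Knn_group n\<^esub> nat (i mod int n)"
    let ?r2 = "rho2 n [^]\<^bsub>Knn_group n\<^esub> nat (j mod int n)"
    have "knn_perm n i j s = ?r1 \<otimes>\<^bsub>Knn_group n\<^esub> ?r2 \<otimes>\<^bsub>Knn_group n\<^esub>
            (if s then tau n else \<one>\<^bsub>Knn_group n\<^esub>)"
      using assms
      by (simp add: rho1_eq rho2_eq tau_eq one_Knn_group pow_Knn_group mult_Knn_group
          knn_perm_eq_iff del: pow_nat)
    also have "\<dots> \<in> carrier (Knn_group n)"
      using gens by simp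
    finally show ?thesis .
  qed
  then show "{knn_perm n i j s | i j s. True} \<subseteq> carrier (Knn_group n)"
    by blast
qed

lemma knn_perm_in_Knn_group [simp]: "n > 0 \<Longrightarrow> knn_perm n i j s \<in> carrier (Knn_group n)"
  by (auto simp: carrier_Knn_group)

lemma Knn_group_cases:
  assumes "n > 0" "g \<in> carrier (Knn_group n)"
  obtains i j s where "g = knn_perm n i j s"
  using assms by (auto simp: carrier_Knn_group)

lemma inv_Knn_group:
  assumes "n > 0"
  shows "inv\<^bsub>Knn_group n\<^esub> knn_perm n i j s =
           knn_perm n (if s then - j else - i) (if s then - i else - j) s"
  using assms
  by (intro group.inv_equality[OF group_Knn_group]) (simp_all add: mult_Knn_group one_Knn_group)

lemma arc_of_knn_perm:
  assumes "n > 0"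
  shows "arc_of n (knn_perm n i j s) =
           (if s then (B (j mod int n), A (i mod int n)) else (A (i mod int n), B (j mod int n)))"
  using assms by (simp add: arc_of_def arc_action_def)

lemma arc_of_eq_iff:
  assumes "n > 0" "g \<in> carrier (Knn_group n)" "h \<in> carrier (Knn_group n)"
  shows "arc_of n g = arc_of n h \<longleftrightarrow> g = h"
proof -
  obtain i j s i' j' t where "g = knn_perm n i j s" "h = knn_perm n i' j' t"
    using assms by (meson Knn_group_cases)
  then show ?thesis
    using assms(1) by (auto simp: arc_of_knn_perm knn_perm_eq_iff)
qed

lemma bij_betw_arc_of:
  assumes "n > 0"
  shows "bij_betw (arc_of n) (carrier (Knn_group n)) (arcs (Knn n))"
  unfolding bij_betw_def
proof
  show "inj_on (arc_of n) (carrier (Knn_group n))"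
    using assms by (simp add: inj_on_def arc_of_eq_iff)
  have "x \<in> arc_of n ` carrier (Knn_group n)" if "x \<in> arcs (Knn n)" for x
    using that
  proof (cases rule: arcs_Knn_cases)
    case (1 i j)
    then have "x = arc_of n (knn_perm n i j False)"
      using assms by (simp add: arc_of_knn_perm)
    then show ?thesis using assms by simp
  next
    case (2 i j)
    then have "x = arc_of n (knn_perm n i j True)"
      using assms by (simp add: arc_of_knn_perm)
    then show ?thesis using assms by simp
  qed
  moreover have "arc_of n g \<in> arcs (Knn n)" if "g \<in> carrier (Knn_group n)" for g
    using assms that by (elim Knn_group_cases[OF assms]) (simp add: arc_of_knn_perm)
  ultimately show "arc_of n ` carrier (Knn_group n) = arcs (Knn n)"
    by blast
qed

lemma group_action_arcs:
  assumes "n > 0"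
  shows "group_action (Knn_group n) (arcs (Knn n)) (arc_action (Knn n))"
proof (rule group_actionI[OF group_Knn_group])
  fix g x assume "g \<in> carrier (Knn_group n)" and x: "x \<in> arcs (Knn n)"
  then obtain i j s where g: "g = knn_perm n i j s"
    using assms by (meson Knn_group_cases)
  from x show "arc_action (Knn n) g x \<in> arcs (Knn n)"
    using assms unfolding g by (cases rule: arcs_Knn_cases) (simp_all add: arc_action_def)
next
  fix x assume "x \<in> arcs (Knn n)"
  then show "arc_action (Knn n) \<one>\<^bsub>Knn_group n\<^esub> x = x"
    using assms by (cases rule: arcs_Knn_cases) (simp_all add: arc_action_def one_Knn_group)
next
  fix g h x assume "g \<in> carrier (Knn_group n)" "h \<in> carrier (Knn_group n)"
    and x: "x \<in> arcs (Knn n)"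
  then obtain i j s i' j' t where g: "g = knn_perm n i j s" and h: "h = knn_perm n i' j' t"
    using assms by (meson Knn_group_cases)
  from x show "arc_action (Knn n) (g \<otimes>\<^bsub>Knn_group n\<^esub> h) x =
      arc_action (Knn n) g (arc_action (Knn n) h x)"
    using assms unfolding g h
    by (cases rule: arcs_Knn_cases)
      (simp_all add: arc_action_def mult_Knn_group mod_simps ac_simps)
qed (simp add: arc_action_def)

text \<open>Everything is referred to the base arc \<open>(A 0, B 0)\<close>, whose orbit map
  \<open>arc_of\<close> is bijective. Surjectivity gives transitivity; if \<open>h\<close> fixes the
  arc labelled \<open>g\<close>, then \<open>hg\<close> and \<open>g\<close> label the same arc, so
  \<open>h\<close> is the identity.\<close>

lemma regular_action_arcs:
  assumes "n > 0"
  shows "regular_action (Knn_group n) (arcs (Knn n)) (arc_action (Knn n))"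
proof -
  let ?G = "Knn_group n" and ?\<phi> = "arc_action (Knn n)"
  interpret group ?G by (rule group_Knn_group)
  interpret group_action ?G "arcs (Knn n)" ?\<phi> by (rule group_action_arcs[OF assms])
  have base: "(A 0, B 0) \<in> arcs (Knn n)"
    using assms by simp
  have ex: "\<exists>g\<in>carrier ?G. x = ?\<phi> g (A 0, B 0)" if "x \<in> arcs (Knn n)" for x
    using bij_betw_imp_surj_on[OF bij_betw_arc_of[OF assms]] that
    by (metis arc_of_def imageE)
  have "\<exists>g\<in>carrier ?G. ?\<phi> g x = y" if x: "x \<in> arcs (Knn n)" and y: "y \<in> arcs (Knn n)" for x y
  proof -
    obtain g where g: "g \<in> carrier ?G" "x = ?\<phi> g (A 0, B 0)"
      using ex[OF x] by blast
    obtain h where h: "h \<in> carrier ?G" "y = ?\<phi> h (A 0, B 0)"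
      using ex[OF y] by blast
    have "?\<phi> (h \<otimes>\<^bsub>?G\<^esub> inv\<^bsub>?G\<^esub> g) x = ?\<phi> (h \<otimes>\<^bsub>?G\<^esub> inv\<^bsub>?G\<^esub> g \<otimes>\<^bsub>?G\<^esub> g) (A 0, B 0)"
      using g h base by (simp add: composition_rule)
    also have "\<dots> = y"
      using g h by (simp add: m_assoc)
    finally show ?thesis
      using g h by blast
  qed
  moreover have "stabilizer ?G ?\<phi> x = {\<one>\<^bsub>?G\<^esub>}" if x: "x \<in> arcs (Knn n)" for x
  proof -
    obtain g where g: "g \<in> carrier ?G" "x = ?\<phi> g (A 0, B 0)"
      using ex[OF x] by blast
    have "h = \<one>\<^bsub>?G\<^esub>" if h: "h \<in> carrier ?G" "?\<phi> h x = x" for h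
    proof -
      have "arc_of n (h \<otimes>\<^bsub>?G\<^esub> g) = arc_of n g"
        using g h base by (simp add: arc_of_def composition_rule)
      then show ?thesis
        using g h assms by (simp add: arc_of_eq_iff)
    qed
    then show ?thesis
      using x by (auto simp: stabilizer_def simp flip: id_eq_one)
  qed
  ultimately show ?thesis
    by (simp add: regular_action_def transitive_action_def transitive_action_axioms_def
        group_action_axioms)
qed


section \<open>The isomorphism type of the group\<close>

lemma group_dihedral_group:
  assumes "n > 0"
  shows "group (dihedral_group n)"
proof (rule groupI)
  fix x assume "x \<in> carrier (dihedral_group n)"
  then obtain i s where x: "x = (i, s)" "0 \<le> i" "i < int n"
    by (auto simp: dihedral_group_def)
  \<comment> \<open>A reflection is its own inverse; a rotation is inverted by negating its
    exponent.\<close>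
  show "\<exists>y\<in>carrier (dihedral_group n). y \<otimes>\<^bsub>dihedral_group n\<^esub> x = \<one>\<^bsub>dihedral_group n\<^esub>"
    using x assms
    by (intro bexI[of _ "(if s then i else (- i) mod int n, s)"])
      (auto simp: dihedral_group_def mod_simps)
next
  fix x y z :: "int \<times> bool"
  obtain i s j t k u where "x = (i, s)" "y = (j, t)" "z = (k, u)"
    by (metis prod.collapse)
  then show "x \<otimes>\<^bsub>dihedral_group n\<^esub> y \<otimes>\<^bsub>dihedral_group n\<^esub> z =
      x \<otimes>\<^bsub>dihedral_group n\<^esub> (y \<otimes>\<^bsub>dihedral_group n\<^esub> z)"
    by (simp add: dihedral_group_def mod_simps) (simp add: algebra_simps)
qed (use assms in \<open>auto simp: dihedral_group_def\<close>)

text \<open>The cyclic factor is the centre, generated by \<open>\<rho>\<^sub>1\<rho>\<^sub>2\<close>; the rotations of the dihedral factor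
  are the powers of \<open>\<rho>\<^sub>1\<rho>\<^sub>2\<^sup>-\<^sup>1\<close>. Together they give all \<open>\<rho>\<^sub>1\<^sup>i\<rho>\<^sub>2\<^sup>j\<close> because \<open>2\<close> is invertible modulo \<open>n\<close>.\<close>

lemma iso_Knn_group:
  assumes "odd n"
  shows "(\<lambda>(x, y, s). knn_perm n (x + y) (x - y) s)
           \<in> iso (integer_mod_group n \<times>\<times> dihedral_group n) (Knn_group n)"
    (is "?f \<in> iso ?H ?G")
proof -
  have n: "n > 0"
    using assms by (cases n) auto
  obtain m where m: "int n = 2 * m + 1"
    using assms by (metis even_of_nat oddE)
  have carrier: "carrier ?H = {0..<int n} \<times> {0..<int n} \<times> UNIV"
    using n by (simp add: carrier_integer_mod_group dihedral_group_def)
  have hom: "?f \<in> hom ?H ?G"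
    unfolding hom_def
  proof (intro CollectI conjI ballI)
    show "?f \<in> carrier ?H \<rightarrow> carrier ?G"
      using n by auto
    fix p q assume "p \<in> carrier ?H" "q \<in> carrier ?H"
    obtain x y s x' y' t where "p = (x, y, s)" "q = (x', y', t)"
      by (metis prod.collapse)
    then show "?f (p \<otimes>\<^bsub>?H\<^esub> q) = ?f p \<otimes>\<^bsub>?G\<^esub> ?f q"
      using n
      by (simp add: dihedral_group_def mult_Knn_group knn_perm_eq_iff mod_simps)
        (simp add: algebra_simps)
  qed
  \<comment> \<open>For odd \<open>n\<close> the factor 2 cancels modulo \<open>n\<close>, and the
    range determines the representative.\<close>
  have half: "x = y" if "0 \<le> x" "x < int n" "0 \<le> y" "y < int n" "int n dvd 2 * (x - y)" for x y
  proof -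
    have "coprime (int n) 2"
      using assms by simp
    then have "int n dvd x - y"
      using that(5) by (simp only: coprime_dvd_mult_right_iff)
    then have "x mod int n = y mod int n"
      by (simp add: mod_eq_dvd_iff)
    then show ?thesis
      using that by simp
  qed
  have "inj_on ?f (carrier ?H)"
  proof (rule inj_onI)
    fix p q assume p: "p \<in> carrier ?H" and q: "q \<in> carrier ?H" and eq: "?f p = ?f q"
    obtain x y s x' y' t where pq: "p = (x, y, s)" "q = (x', y', t)"
      by (metis prod.collapse)
    have dvd: "int n dvd (x + y) - (x' + y')" "int n dvd (x - y) - (x' - y')" and s: "s = t"
      using eq n by (simp_all add: pq knn_perm_eq_iff mod_eq_dvd_iff)
    \<comment> \<open>Adding and subtracting the two congruences isolates each coordinate.\<close>
    have "int n dvd 2 * (x - x')" "int n dvd 2 * (y - y')"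
      using dvd_add[OF dvd] dvd_diff[OF dvd] by (simp_all add: algebra_simps)
    then show "p = q"
      using p q s by (auto simp: pq carrier[unfolded carrier_DirProd] intro: half)
  qed
  moreover have "g \<in> ?f ` carrier ?H" if "g \<in> carrier ?G" for g
  proof -
    obtain i j s where g: "g = knn_perm n i j s"
      using n \<open>g \<in> carrier ?G\<close> by (rule Knn_group_cases)
    \<comment> \<open>Solves \<open>x + y = i\<close> and \<open>x - y = j\<close> modulo
      \<open>n\<close>: \<open>m + 1\<close> is the inverse of 2, as
      \<open>2 * (m + 1) = n + 1\<close>.\<close>
    let ?p = "(((m + 1) * (i + j)) mod int n, ((m + 1) * (i - j)) mod int n, s)"
    have "(m + 1) * (i + j) + (m + 1) * (i - j) = i + int n * i"
      "(m + 1) * (i + j) - (m + 1) * (i - j) = j + int n * j"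
      by (simp_all add: m algebra_simps)
    then have "g = ?f ?p"
      using n by (simp add: g knn_perm_eq_iff mod_simps)
    moreover have "?p \<in> carrier ?H"
      using n by (simp add: carrier[unfolded carrier_DirProd])
    ultimately show ?thesis by (rule image_eqI)
  qed
  ultimately have "bij_betw ?f (carrier ?H) (carrier ?G)"
    using n by (auto simp: bij_betw_def)
  with hom show ?thesis
    by (simp add: iso_def)
qed



section \<open>The connection set and the line graph\<close>

text \<open>Letting the exponent be any integer not divisible by \<open>n\<close> makes closure
  under inverses visible as negation of \<open>k\<close>.\<close>

lemma Knn_conn_eq:
  assumes "n > 0"
  shows "Knn_conn n = {knn_perm n 0 0 True} \<union> {knn_perm n 0 k False | k. \<not> int n dvd k}"
proof -
  have "(\<exists>i. x = knn_perm n 0 (int i) False \<and> 1 \<le> i \<and> i \<le> n - 1) \<longleftrightarrow>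
      (\<exists>k. x = knn_perm n 0 k False \<and> \<not> int n dvd k)" for x
  proof
    assume "\<exists>i. x = knn_perm n 0 (int i) False \<and> 1 \<le> i \<and> i \<le> n - 1"
    then obtain i where i: "x = knn_perm n 0 (int i) False" "1 \<le> i" "i \<le> n - 1"
      by blast
    then have "\<not> int n dvd int i"
      using assms by (auto dest: dvd_imp_le)
    with i show "\<exists>k. x = knn_perm n 0 k False \<and> \<not> int n dvd k"
      by blast
  next
    assume "\<exists>k. x = knn_perm n 0 k False \<and> \<not> int n dvd k"
    then obtain k where k: "x = knn_perm n 0 k False" "\<not> int n dvd k"
      by blast
    have "k mod int n \<noteq> 0" "0 \<le> k mod int n" "k mod int n < int n"
      using k assms by (auto simp: dvd_eq_mod_eq_0)
    then have "1 \<le> nat (k mod int n)" "nat (k mod int n) \<le> n - 1"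
      by linarith+
    moreover have "x = knn_perm n 0 (int (nat (k mod int n))) False"
      using k assms by (simp add: knn_perm_eq_iff)
    ultimately show "\<exists>i. x = knn_perm n 0 (int i) False \<and> 1 \<le> i \<and> i \<le> n - 1"
      by blast
  qed
  then show ?thesis
    using assms by (auto simp: Knn_conn_def tau_eq rho2_eq pow_Knn_group)
qed

lemma Knn_conn_subset:
  assumes "n > 0"
  shows "Knn_conn n \<subseteq> carrier (Knn_group n) - {\<one>\<^bsub>Knn_group n\<^esub>}"
  using assms
  by (auto simp: Knn_conn_eq one_Knn_group knn_perm_eq_iff dvd_eq_mod_eq_0)

lemma inv_in_Knn_conn:
  assumes "n > 0" "c \<in> Knn_conn n"
  shows "inv\<^bsub>Knn_group n\<^esub> c \<in> Knn_conn n"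
proof -
  have "\<exists>k'. knn_perm n 0 (- k) False = knn_perm n 0 k' False \<and> \<not> int n dvd k'"
    if "\<not> int n dvd k" for k
    using that by (intro exI[of _ "- k"]) simp
  then show ?thesis
    using assms by (auto simp: Knn_conn_eq inv_Knn_group)
qed

text \<open>The generator \<open>tau\<close> flips only the flag. A power of \<open>rho2\<close>
  changes the index of the head of the arc, which is \<open>j\<close> if \<open>s\<close> is false
  and \<open>i\<close> if \<open>s\<close> is true.\<close>

lemma edges_cayley_Knn_iff:
  assumes "n > 0"
  shows "{knn_perm n i j s, knn_perm n i' j' t} \<in> edges (cayley_graph (Knn_group n) (Knn_conn n)) \<longleftrightarrow>
     (if s \<noteq> t then i mod int n = i' mod int n \<and> j mod int n = j' mod int n
      else if s then i mod int n \<noteq> i' mod int n \<and> j mod int n = j' mod int n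
      else i mod int n = i' mod int n \<and> j mod int n \<noteq> j' mod int n)"
proof -
  \<comment> \<open>The witness for \<open>k\<close> is the difference \<open>b - a\<close>.\<close>
  have shift: "(\<exists>k. \<not> int n dvd k \<and> b mod int n = (a + k) mod int n) \<longleftrightarrow> a mod int n \<noteq> b mod int n"
    for a b
  proof
    assume "\<exists>k. \<not> int n dvd k \<and> b mod int n = (a + k) mod int n"
    then show "a mod int n \<noteq> b mod int n"
      by (metis add.commute add_diff_cancel_right' mod_eq_dvd_iff)
  next
    assume "a mod int n \<noteq> b mod int n"
    then show "\<exists>k. \<not> int n dvd k \<and> b mod int n = (a + k) mod int n"
      by (intro exI[of _ "b - a"]) (auto simp: mod_eq_dvd_iff dvd_diff_commute)
  qed
  have "{knn_perm n i j s, knn_perm n i' j' t} \<in> edges (cayley_graph (Knn_group n) (Knn_conn n)) \<longleftrightarrow>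
      (\<exists>c\<in>Knn_conn n. knn_perm n i' j' t = knn_perm n i j s \<otimes>\<^bsub>Knn_group n\<^esub> c)"
    using assms Knn_conn_subset[OF assms]
    by (intro edges_cayley_graph_iff group_Knn_group inv_in_Knn_conn) auto
  also have "\<dots> \<longleftrightarrow> knn_perm n i' j' t = knn_perm n i j (\<not> s) \<or>
      (\<exists>k. \<not> int n dvd k \<and>
        knn_perm n i' j' t = (if s then knn_perm n (i + k) j True else knn_perm n i (j + k) False))"
  proof -
    have "knn_perm n i j s \<otimes>\<^bsub>Knn_group n\<^esub> knn_perm n 0 0 True = knn_perm n i j (\<not> s)"
      "knn_perm n i j s \<otimes>\<^bsub>Knn_group n\<^esub> knn_perm n 0 k False =
         (if s then knn_perm n (i + k) j True else knn_perm n i (j + k) False)" for k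
      using assms by (simp_all add: mult_Knn_group)
    then show ?thesis
      unfolding Knn_conn_eq[OF assms] by (auto split del: if_split)
  qed
  also have "\<dots> \<longleftrightarrow>
     (if s \<noteq> t then i mod int n = i' mod int n \<and> j mod int n = j' mod int n
      else if s then i mod int n \<noteq> i' mod int n \<and> j mod int n = j' mod int n
      else i mod int n = i' mod int n \<and> j mod int n \<noteq> j' mod int n)"
    by (cases s; cases t; simp add: knn_perm_eq_iff[OF assms] flip: shift; metis)
  finally show ?thesis .
qed

section \<open>Half-edges as vertices of the line graph of a subdivision\<close>

lemma half_edge_eq_iff: "half_edge x = half_edge y \<longleftrightarrow> x = y"
  by (cases x; cases y) (auto simp: doubleton_eq_iff)

lemma half_edge_in_subdivision: "x \<in> arcs X \<Longrightarrow> half_edge x \<in> edges (subdivision X)"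
  by (cases x) (auto simp: arcs_def subdivision_def)

text \<open>An edge with at most two elements and one of its ends determine the other end, hence an
  arc.\<close>

lemma bij_betw_half_edge:
  assumes "\<And>e. e \<in> edges X \<Longrightarrow> \<exists>u w. e = {u, w}"
  shows "bij_betw half_edge (arcs X) (verts (line_graph (subdivision X)))"
  unfolding bij_betw_def
proof
  show "inj_on half_edge (arcs X)"
    by (simp add: inj_on_def half_edge_eq_iff)
  have "E \<in> half_edge ` arcs X" if E: "E \<in> edges (subdivision X)" for E
  proof -
    obtain v e where e: "E = {Inl v, Inr e}" "e \<in> edges X" "v \<in> e"
      using E by (auto simp: subdivision_def)
    then obtain w where "e = {v, w}"
      using assms by (metis doubleton_eq_iff insertE singletonD)
    with e have "E = half_edge (v, w)" "(v, w) \<in> arcs X"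
      by (auto simp: arcs_def)
    then show ?thesis by blast
  qed
  then show "half_edge ` arcs X = verts (line_graph (subdivision X))"
    by (auto simp: line_graph_def half_edge_in_subdivision simp del: half_edge.simps)
qed

text \<open>Half-edges meet at an original vertex when the tails agree, and at a midpoint when the
  arcs have the same underlying edge, so that distinct ones are reverses of each other.\<close>

lemma edges_line_graph_subdivision_iff:
  assumes "x \<in> arcs X" "y \<in> arcs X"
  shows "{half_edge x, half_edge y} \<in> edges (line_graph (subdivision X)) \<longleftrightarrow>
           x \<noteq> y \<and> (fst x = fst y \<or> x = prod.swap y)"
proof -
  have "half_edge x \<in> edges (subdivision X)" "half_edge y \<in> edges (subdivision X)"
    using assms by (simp_all add: half_edge_in_subdivision)
  then have "{half_edge x, half_edge y} \<in> edges (line_graph (subdivision X)) \<longleftrightarrow>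
      half_edge x \<noteq> half_edge y \<and> half_edge x \<inter> half_edge y \<noteq> {}"
    unfolding line_graph_def by (simp add: doubleton_eq_iff) blast
  also have "\<dots> \<longleftrightarrow> x \<noteq> y \<and> (fst x = fst y \<or> x = prod.swap y)"
    by (cases x; cases y) (auto simp: half_edge_eq_iff doubleton_eq_iff)
  finally show ?thesis .
qed

lemma graph_iso_cayley_line_graph:
  assumes "n > 0"
  shows "graph_iso (\<lambda>g. half_edge (arc_of n g))
           (cayley_graph (Knn_group n) (Knn_conn n)) (line_graph (subdivision (Knn n)))"
  unfolding graph_iso_def
proof (intro conjI ballI)
  have "bij_betw half_edge (arcs (Knn n)) (verts (line_graph (subdivision (Knn n))))"
    by (rule bij_betw_half_edge) (auto simp: Knn_def)
  then have "bij_betw (half_edge \<circ> arc_of n) (carrier (Knn_group n))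
      (verts (line_graph (subdivision (Knn n))))"
    by (rule bij_betw_trans[OF bij_betw_arc_of[OF assms]])
  then show "bij_betw (\<lambda>g. half_edge (arc_of n g))
      (verts (cayley_graph (Knn_group n) (Knn_conn n))) (verts (line_graph (subdivision (Knn n))))"
    by (simp add: cayley_graph_def comp_def)
next
  fix x y
  assume "x \<in> verts (cayley_graph (Knn_group n) (Knn_conn n))"
    and "y \<in> verts (cayley_graph (Knn_group n) (Knn_conn n))"
  then have xy: "x \<in> carrier (Knn_group n)" "y \<in> carrier (Knn_group n)"
    by (simp_all add: cayley_graph_def)
  then have arcs: "arc_of n x \<in> arcs (Knn n)" "arc_of n y \<in> arcs (Knn n)"
    using bij_betw_arc_of[OF assms] by (auto simp: bij_betw_def)
  from xy obtain i j s i' j' t where "x = knn_perm n i j s" "y = knn_perm n i' j' t"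
    using assms by (meson Knn_group_cases)
  then show "{x, y} \<in> edges (cayley_graph (Knn_group n) (Knn_conn n)) \<longleftrightarrow>
      {half_edge (arc_of n x), half_edge (arc_of n y)} \<in> edges (line_graph (subdivision (Knn n)))"
    unfolding edges_line_graph_subdivision_iff[OF arcs]
    using assms by (auto simp: edges_cayley_Knn_iff arc_of_knn_perm)
qed


section \<open>The colour-preserving automorphism\<close>

lemma arc_action_sigma2:
  assumes "n > 0"
  shows "arc_action (Knn n) (sigma2 n) (arc_of n (knn_perm n i j s)) = arc_of n (knn_perm n i (- j) s)"
  using assms by (simp add: arc_of_knn_perm arc_action_def mod_minus_eq)

lemma sigma2_induced_ex1:
  assumes "n > 0" "g \<in> carrier (Knn_group n)"
  shows "\<exists>!h. h \<in> carrier (Knn_group n) \<and>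
           arc_of n h = arc_action (Knn n) (sigma2 n) (arc_of n g)"
proof -
  obtain i j s where g: "g = knn_perm n i j s"
    using assms by (rule Knn_group_cases)
  show ?thesis
    unfolding g arc_action_sigma2[OF assms(1)]
    using assms(1) by (intro ex1I[of _ "knn_perm n i (- j) s"]) (auto simp: arc_of_eq_iff)
qed

lemma sigma2_induced_knn_perm:
  assumes "n > 0"
  shows "sigma2_induced n (knn_perm n i j s) = knn_perm n i (- j) s"
  unfolding sigma2_induced_def
  using assms
  by (intro the1_equality sigma2_induced_ex1) (simp_all add: arc_action_sigma2)

lemma colour_preserving_sigma2_induced:
  assumes "n > 0"
  shows "colour_preserving_automorphism (Knn_group n) (Knn_conn n) (sigma2_induced n)"
  unfolding colour_preserving_automorphism_def
proof (intro conjI allI impI)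
  let ?G = "Knn_group n" and ?C = "Knn_conn n" and ?f = "sigma2_induced n"
  have neg: "(- a) mod int n = (- b) mod int n \<longleftrightarrow> a mod int n = b mod int n" for a b
    by (simp add: mod_eq_dvd_iff dvd_diff_commute)
  \<comment> \<open>Negating \<open>j\<close> twice does nothing, so \<open>?f\<close> is its own
    inverse.\<close>
  have "bij_betw ?f (carrier ?G) (carrier ?G)"
    using assms
    by (intro bij_betw_byWitness[where f' = ?f])
      (auto simp: sigma2_induced_knn_perm elim!: Knn_group_cases[OF assms])
  moreover have "{x, y} \<in> edges (cayley_graph ?G ?C) \<longleftrightarrow> {?f x, ?f y} \<in> edges (cayley_graph ?G ?C)"
    if xy: "x \<in> carrier ?G" "y \<in> carrier ?G" for x y
  proof -
    from xy obtain i j s i' j' t where "x = knn_perm n i j s" "y = knn_perm n i' j' t"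
      using assms by (meson Knn_group_cases)
    then show ?thesis
      using assms by (simp add: sigma2_induced_knn_perm edges_cayley_Knn_iff neg)
  qed
  ultimately show "graph_iso ?f (cayley_graph ?G ?C) (cayley_graph ?G ?C)"
    by (simp add: graph_iso_def cayley_graph_def)
  fix E K assume "cayley_coloured ?G ?C E K"
  then obtain g c where g: "g \<in> carrier ?G" and c: "c \<in> ?C"
    and E: "E = {g, g \<otimes>\<^bsub>?G\<^esub> c}" and K: "K = {c, inv\<^bsub>?G\<^esub> c}"
    by (auto simp: cayley_coloured_def)
  obtain i j s where gP: "g = knn_perm n i j s"
    using assms g by (rule Knn_group_cases)
  have fg: "?f g \<in> carrier ?G"
    using assms by (simp add: gP sigma2_induced_knn_perm)
  have c_carrier: "c \<in> carrier ?G"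
    using c Knn_conn_subset[OF assms] by blast
  \<comment> \<open>The first alternative holds for \<open>tau\<close>, and for powers of
    \<open>rho2\<close> if \<open>s\<close> is true, since then only \<open>i\<close> moves. If
    \<open>s\<close> is false, such a power moves the negated index \<open>j\<close>, giving the
    second.\<close>
  have "?f (g \<otimes>\<^bsub>?G\<^esub> c) = ?f g \<otimes>\<^bsub>?G\<^esub> c \<or> ?f (g \<otimes>\<^bsub>?G\<^esub> c) = ?f g \<otimes>\<^bsub>?G\<^esub> inv\<^bsub>?G\<^esub> c"
    using c unfolding Knn_conn_eq[OF assms]
    by (auto simp: gP mult_Knn_group inv_Knn_group sigma2_induced_knn_perm assms)
  then obtain d where d: "d \<in> {c, inv\<^bsub>?G\<^esub> c}" "?f (g \<otimes>\<^bsub>?G\<^esub> c) = ?f g \<otimes>\<^bsub>?G\<^esub> d"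
    by blast
  \<comment> \<open>The colour is symmetric in \<open>c\<close> and its inverse, so either choice of
    \<open>d\<close> yields it.\<close>
  have "d \<in> ?C" "K = {d, inv\<^bsub>?G\<^esub> d}"
    using d c c_carrier K inv_in_Knn_conn[OF assms c] group.inv_inv[OF group_Knn_group] by auto
  moreover have "?f ` E = {?f g, ?f g \<otimes>\<^bsub>?G\<^esub> d}"
    using d by (simp add: E)
  ultimately show "cayley_coloured ?G ?C (?f ` E) K"
    using fg unfolding cayley_coloured_def by blast
qed

text \<open>The induced permutation fixes the identity, so if it were affine it would be multiplicative;
  on \<open>\<tau>\<rho>\<^sub>2 = \<rho>\<^sub>1\<tau>\<close> this would give \<open>\<rho>\<^sub>1 = \<rho>\<^sub>1\<^sup>-\<^sup>1\<close>.\<close>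

lemma not_affine_sigma2_induced:
  assumes "n \<ge> 3"
  shows "\<not> affine_map (Knn_group n) (sigma2_induced n)"
proof
  let ?G = "Knn_group n" and ?f = "sigma2_induced n"
  interpret group ?G by (rule group_Knn_group)
  have n: "n > 0" using assms by simp
  assume "affine_map ?G ?f"
  then obtain h \<alpha> where h: "h \<in> carrier ?G" and \<alpha>: "\<alpha> \<in> hom ?G ?G"
    and f: "\<And>g. g \<in> carrier ?G \<Longrightarrow> ?f g = h \<otimes>\<^bsub>?G\<^esub> \<alpha> g"
    by (auto simp: affine_map_def auto_def)
  have "\<alpha> \<one>\<^bsub>?G\<^esub> = \<one>\<^bsub>?G\<^esub>"
    using \<alpha> group_Knn_group by (simp add: hom_one)
  moreover have "?f \<one>\<^bsub>?G\<^esub> = \<one>\<^bsub>?G\<^esub>"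
    using n by (simp add: one_Knn_group sigma2_induced_knn_perm)
  ultimately have "h = \<one>\<^bsub>?G\<^esub>"
    using f[of "\<one>\<^bsub>?G\<^esub>"] h by simp
  then have f\<alpha>: "?f g = \<alpha> g" if "g \<in> carrier ?G" for g
    using f that hom_in_carrier[OF \<alpha>] by simp
  let ?t = "knn_perm n 0 0 True" and ?r = "knn_perm n 0 1 False"
  have "?f (?t \<otimes>\<^bsub>?G\<^esub> ?r) = ?f ?t \<otimes>\<^bsub>?G\<^esub> ?f ?r"
    using n hom_mult[OF \<alpha>, of ?t ?r] by (simp only: f\<alpha> m_closed knn_perm_in_Knn_group)
  then have "1 mod int n = (- 1) mod int n"
    using n by (simp add: mult_Knn_group sigma2_induced_knn_perm knn_perm_eq_iff)
  then have "int n dvd 2"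
    by (simp add: mod_eq_dvd_iff)
  then show False
    using assms by (auto dest: zdvd_imp_le)
qed

text \<open>The claims on the abstract product are made for every identification
  \<open>\<phi>\<close> of the two groups; the isomorphism conjunct ensures that one exists.\<close>

theorem theorem3p1:
  fixes n :: nat
  assumes "n \<ge> 3" and "odd n"
  shows
    "{rho1 n, rho2 n, tau n, sigma2 n} \<subseteq> carrier (BijGroup (verts (Knn n))) \<and>
     tau n \<otimes>\<^bsub>BijGroup (verts (Knn n))\<^esub> tau n = \<one>\<^bsub>BijGroup (verts (Knn n))\<^esub> \<and>
     tau n \<noteq> \<one>\<^bsub>BijGroup (verts (Knn n))\<^esub> \<and>
     tau n \<otimes>\<^bsub>BijGroup (verts (Knn n))\<^esub> (rho1 n \<otimes>\<^bsub>BijGroup (verts (Knn n))\<^esub> rho2 n)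
       = (rho1 n \<otimes>\<^bsub>BijGroup (verts (Knn n))\<^esub> rho2 n) \<otimes>\<^bsub>BijGroup (verts (Knn n))\<^esub> tau n \<and>
     tau n ` side_A n = side_B n \<and> tau n ` side_B n = side_A n \<and>
     sigma2 n \<otimes>\<^bsub>BijGroup (verts (Knn n))\<^esub> sigma2 n = \<one>\<^bsub>BijGroup (verts (Knn n))\<^esub> \<and>
     sigma2 n \<noteq> \<one>\<^bsub>BijGroup (verts (Knn n))\<^esub> \<and>
     sigma2 n \<otimes>\<^bsub>BijGroup (verts (Knn n))\<^esub> rho2 n \<otimes>\<^bsub>BijGroup (verts (Knn n))\<^esub>
         inv\<^bsub>BijGroup (verts (Knn n))\<^esub> sigma2 n
       = inv\<^bsub>BijGroup (verts (Knn n))\<^esub> rho2 n \<and>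
     sigma2 n (B 0) = B 0 \<and>

     Knn_group n \<cong> integer_mod_group n \<times>\<times> dihedral_group n \<and>
     regular_action (Knn_group n) (arcs (Knn n)) (arc_action (Knn n)) \<and>

     bij_betw half_edge (arcs (Knn n)) (verts (line_graph (subdivision (Knn n)))) \<and>
     Knn_conn n \<subseteq> carrier (Knn_group n) - {\<one>\<^bsub>Knn_group n\<^esub>} \<and>
     graph_iso (\<lambda>g. half_edge (arc_of n g))
       (cayley_graph (Knn_group n) (Knn_conn n)) (line_graph (subdivision (Knn n))) \<and>

     \<not> CCA (Knn_group n) (Knn_conn n) \<and>
     (\<forall>\<phi> \<in> iso (Knn_group n) (integer_mod_group n \<times>\<times> dihedral_group n).
        graph_isomorphic (line_graph (subdivision (Knn n)))
          (cayley_graph (integer_mod_group n \<times>\<times> dihedral_group n) (\<phi> ` Knn_conn n)) \<and>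
        \<not> CCA (integer_mod_group n \<times>\<times> dihedral_group n) (\<phi> ` Knn_conn n)) \<and>

     (\<forall>g \<in> carrier (Knn_group n). \<exists>!h. h \<in> carrier (Knn_group n) \<and>
        arc_of n h = arc_action (Knn n) (sigma2 n) (arc_of n g)) \<and>
     colour_preserving_automorphism (Knn_group n) (Knn_conn n) (sigma2_induced n) \<and>
     \<not> affine_map (Knn_group n) (sigma2_induced n)"
proof -
  let ?X = "BijGroup (verts (Knn n))" and ?G = "Knn_group n" and ?C = "Knn_conn n"
    and ?H = "integer_mod_group n \<times>\<times> dihedral_group n"
    and ?L = "line_graph (subdivision (Knn n))"
  have n: "n > 0" using assms by simp
  have H: "group ?H"
    by (intro DirProd_group group_integer_mod_group group_dihedral_group n)
  have C: "?C \<subseteq> carrier ?G"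
    using Knn_conn_subset[OF n] by blast
  have not_CCA: "\<not> CCA ?G ?C"
    using colour_preserving_sigma2_induced[OF n] not_affine_sigma2_induced[OF assms(1)]
    by (auto simp: CCA_def)
  have perms: "{rho1 n, rho2 n, tau n, sigma2 n} \<subseteq> carrier ?X"
    by (simp add: rho1_eq rho2_eq tau_eq knn_perm_in_BijGroup n) (simp add: BijGroup_def sigma2_Bij)
  have tau: "tau n \<otimes>\<^bsub>?X\<^esub> tau n = \<one>\<^bsub>?X\<^esub>" "tau n \<noteq> \<one>\<^bsub>?X\<^esub>"
    "tau n \<otimes>\<^bsub>?X\<^esub> (rho1 n \<otimes>\<^bsub>?X\<^esub> rho2 n) = (rho1 n \<otimes>\<^bsub>?X\<^esub> rho2 n) \<otimes>\<^bsub>?X\<^esub> tau n"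
    using n by (simp_all add: tau_eq rho1_eq rho2_eq one_BijGroup_Knn mult_BijGroup_knn_perm
        knn_perm_eq_iff)
  have sides: "tau n ` side_A n = side_B n" "tau n ` side_B n = side_A n"
    using n by (simp_all add: side_A_def side_B_def tau_eq image_image cong: image_cong_simp)
  \<comment> \<open>As \<open>n\<close> is at least 3, the index \<open>n - 1\<close> differs from
    1, so \<open>sigma2 n\<close> is not the identity.\<close>
  have "sigma2 n (B 1) = B (int n - 1)"
    using assms(1) by (simp add: zmod_minus1)
  then have "sigma2 n (B 1) \<noteq> \<one>\<^bsub>?X\<^esub> (B 1)"
    using assms(1) by (simp add: BijGroup_def)
  then have sigma2: "sigma2 n \<noteq> \<one>\<^bsub>?X\<^esub>" "sigma2 n (B 0) = B 0"
    using n by auto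
  have "inv_into (carrier ?H) (\<lambda>(x, y, s). knn_perm n (x + y) (x - y) s) \<in> iso ?G ?H"
    by (rule group.iso_set_sym[OF H iso_Knn_group[OF assms(2)]])
  then have G_iso: "?G \<cong> ?H"
    by (auto simp: is_iso_def)
  have half_edges: "bij_betw half_edge (arcs (Knn n)) (verts ?L)"
    by (rule bij_betw_half_edge) (auto simp: Knn_def)
  have transport: "graph_isomorphic ?L (cayley_graph ?H (\<phi> ` ?C)) \<and> \<not> CCA ?H (\<phi> ` ?C)"
    if "\<phi> \<in> iso ?G ?H" for \<phi>
    using graph_iso_comp[OF graph_iso_inv_into[OF graph_iso_cayley_line_graph[OF n]]
        graph_iso_cayley_graph[OF that C group_Knn_group]]
      CCA_iso[OF that C group_Knn_group H] not_CCA
    by (auto simp: graph_isomorphic_def)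
  show ?thesis
    by (intro conjI ballI perms tau sides sigma2 sigma2_squared sigma2_inverts_rho2 n G_iso
        regular_action_arcs half_edges Knn_conn_subset graph_iso_cayley_line_graph not_CCA
        transport[THEN conjunct1] transport[THEN conjunct2] sigma2_induced_ex1
        colour_preserving_sigma2_induced not_affine_sigma2_induced assms(1))
qed

end
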